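(* (i) Let $|x\rangle,|y\rangle$ be orthogonal $n$-qubit states, and suppose that a unitary $U$ satisfies $\langle y|U|x\rangle=a$ and $\langle x|U|y\rangle=b$. Then using a single black-box access to controlled-$U$, plus $O(1)$ additional gates, we can distinguish $|\psi\rangle=\frac{|x\rangle+|y\rangle}{\sqrt2}$ from $|\phi\rangle=\frac{|x\rangle-|y\rangle}{\sqrt2}$ with bias $\Delta=\frac{|a+b|}{2}$. (ii) Let $|\psi\rangle,|\phi\rangle$ be orthogonal $n$-qubit states, and suppose the procedure $A$ accepts $|\psi\rangle$ with probability $p$ and $|\phi\rangle$ with probability $p-\Delta$, i.e. $A$ distinguishes $|\psi\rangle$ from $|\phi\rangle$ with bias $\Delta$ (where $\Delta\ge0$). Then using a single black-box access each to $A$ and $A^\dagger$, and a single additional gate, we can apply a unitary $U$ such that $$\frac{\left|\langle y|U|x\rangle+\langle x|U|y\rangle\right|}{2}=\Delta,$$ where $|x\rangle=\frac{|\psi\rangle+|\phi\rangle}{\sqrt2}$ and $|y\rangle=\frac{|\psi\rangle-|\phi\rangle}{\sqrt2}$.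
   Context: States are unit vectors. Gates are chosen from an arbitrary fixed universal set of 1-qubit and 2-qubit gates. Controlled-$U$ applies $U$ conditioned on a control qubit being $|1\rangle$. A distinguishing procedure $A$ is a unitary followed by a measurement of the first qubit in the computational basis; it accepts when the outcome is $1$. Two states are distinguished with bias $\Delta$ if the acceptance probabilities on the two states differ by $\Delta$.
   Formalization: "Universal" is taken as exact: every 2-qubit unitary is obtained up to global phase with a uniformly bounded number of gates (exact bias fails for countable gate sets); in (ii) the single additional gate is Pauli Z, adjoined to the gate set if absent. *)

theory Defs
  imports "Jordan_Normal_Form.Schur_Decomposition"
begin

text \<open>
  Conventions. An n-qubit vector is an element of \<open>carrier_vec (2 ^ n)\<close>. The amplitude of
  the basis state with bits \<open>b\<^sub>0 \<dots> b\<^sub>n\<^sub>-\<^sub>1\<close> has the index whose binary expansion is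
  \<open>b\<^sub>0 \<dots> b\<^sub>n\<^sub>-\<^sub>1\<close>, most significant bit first, so wire 0 is the first qubit.
  The library's \<open>v \<bullet>c w\<close> is conjugate-linear in \<open>w\<close>; hence
  \<open>(U *\<^sub>v x) \<bullet>c y\<close> is the matrix element of \<open>U\<close> with bra \<open>y\<close> and ket \<open>x\<close>.
\<close>

definition is_state :: "nat \<Rightarrow> complex vec \<Rightarrow> bool" where
  "is_state n v \<longleftrightarrow> v \<in> carrier_vec (2 ^ n) \<and> v \<bullet>c v = 1"

definition is_unitary :: "nat \<Rightarrow> complex mat \<Rightarrow> bool" where
  "is_unitary d U \<longleftrightarrow> U \<in> carrier_mat d d \<and> mat_adjoint U * U = 1\<^sub>m d"

text \<open>\<open>ket_plus x y\<close> and \<open>ket_minus x y\<close> are the normalised sum and difference.\<close>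

definition ket_plus :: "complex vec \<Rightarrow> complex vec \<Rightarrow> complex vec" where
  "ket_plus x y = (1 / complex_of_real (sqrt 2)) \<cdot>\<^sub>v (x + y)"

definition ket_minus :: "complex vec \<Rightarrow> complex vec \<Rightarrow> complex vec" where
  "ket_minus x y = (1 / complex_of_real (sqrt 2)) \<cdot>\<^sub>v (x - y)"

text \<open>\<open>with_ancillas m n v\<close> is the tensor product of the all-zero state on m ancilla wires
  (wires \<open>0, \<dots>, m - 1\<close>) with the n-qubit vector v (wires \<open>m, \<dots>, m + n - 1\<close>).\<close>

definition with_ancillas :: "nat \<Rightarrow> nat \<Rightarrow> complex vec \<Rightarrow> complex vec" where
  "with_ancillas m n v = vec (2 ^ (m + n)) (\<lambda>r. if r < 2 ^ n then v $ r else 0)"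

text \<open>The control is the first of the qubits on which \<open>controlled U\<close> acts.\<close>

definition controlled :: "complex mat \<Rightarrow> complex mat" where
  "controlled U = (let d = dim_row U in four_block_mat (1\<^sub>m d) (0\<^sub>m d d) (0\<^sub>m d d) U)"

definition pauli_z :: "complex mat" where
  "pauli_z = mat_of_rows_list 2 [[1, 0], [0, -1]]"

text \<open>\<open>wire_bit N w r\<close> is the bit on wire w in the N-wire basis state with index r, and
  \<open>sub_index N ws r\<close> is the index of the basis state obtained by reading off the wires ws
  in the order listed. \<open>on_wires N ws M\<close> is M acting on the wires ws, tensored with the
  identity on the remaining wires.\<close>

definition wire_bit :: "nat \<Rightarrow> nat \<Rightarrow> nat \<Rightarrow> nat" where
  "wire_bit N w r = r div 2 ^ (N - 1 - w) mod 2"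

definition sub_index :: "nat \<Rightarrow> nat list \<Rightarrow> nat \<Rightarrow> nat" where
  "sub_index N ws r = foldl (\<lambda>k w. 2 * k + wire_bit N w r) 0 ws"

definition on_wires :: "nat \<Rightarrow> nat list \<Rightarrow> complex mat \<Rightarrow> complex mat" where
  "on_wires N ws M = mat (2 ^ N) (2 ^ N) (\<lambda>(r, s).
     if \<forall>w<N. w \<notin> set ws \<longrightarrow> wire_bit N w r = wire_bit N w s
     then M $$ (sub_index N ws r, sub_index N ws s) else 0)"

text \<open>\<open>Query j ws\<close> applies the j-th black box to the wires ws. A circuit is a list of
  instructions, the head being executed first. The black boxes are not part of the circuit:
  they are supplied only when its operator is formed, so a circuit is fixed independently of
  what the black boxes are.\<close>

datatype instruction =
  is_gate: Gate "complex mat" "nat list"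
| is_query: Query nat "nat list"

type_synonym circuit = "instruction list"

fun instruction_op :: "complex mat list \<Rightarrow> nat \<Rightarrow> instruction \<Rightarrow> complex mat" where
  "instruction_op bbs N (Gate g ws) = on_wires N ws g"
| "instruction_op bbs N (Query j ws) = on_wires N ws (bbs ! j)"

fun circuit_op :: "complex mat list \<Rightarrow> nat \<Rightarrow> circuit \<Rightarrow> complex mat" where
  "circuit_op bbs N [] = 1\<^sub>m (2 ^ N)"
| "circuit_op bbs N (I # C) = circuit_op bbs N C * instruction_op bbs N I"

text \<open>In \<open>circuit_over G ks N C\<close>, the list ks gives the numbers of qubits on which the
  black boxes act.\<close>

fun instruction_over :: "complex mat set \<Rightarrow> nat list \<Rightarrow> nat \<Rightarrow> instruction \<Rightarrow> bool" where
  "instruction_over G ks N (Gate g ws) \<longleftrightarrow>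
     g \<in> G \<and> dim_row g = 2 ^ length ws \<and> distinct ws \<and> set ws \<subseteq> {..<N}"
| "instruction_over G ks N (Query j ws) \<longleftrightarrow>
     j < length ks \<and> length ws = ks ! j \<and> distinct ws \<and> set ws \<subseteq> {..<N}"

definition circuit_over :: "complex mat set \<Rightarrow> nat list \<Rightarrow> nat \<Rightarrow> circuit \<Rightarrow> bool" where
  "circuit_over G ks N C \<longleftrightarrow> (\<forall>I\<in>set C. instruction_over G ks N I)"

definition gate_count :: "circuit \<Rightarrow> nat" where
  "gate_count C = length (filter is_gate C)"

definition query_count :: "nat \<Rightarrow> circuit \<Rightarrow> nat" where
  "query_count j C = length (filter (\<lambda>I. \<exists>ws. I = Query j ws) C)"

text \<open>Universality is exact (for a merely dense gate set an exact bias is out of reach) and up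
  to a global phase. The bound K is uniform over all two-qubit unitaries, so that changing the
  gate set changes gate counts by at most a constant factor. For a closed gate set that
  generates all two-qubit unitaries up to phase, such a K exists by compactness and the Baire
  category theorem. One-qubit unitaries are the case of V acting trivially on one wire.\<close>

definition universal_gate_set :: "complex mat set \<Rightarrow> bool" where
  "universal_gate_set G \<longleftrightarrow>
     (\<forall>g\<in>G. is_unitary 2 g \<or> is_unitary 4 g) \<and>
     (\<exists>K. \<forall>V. is_unitary 4 V \<longrightarrow>
        (\<exists>C c. circuit_over G [] 2 C \<and> gate_count C \<le> K \<and> cmod c = 1 \<and>
               circuit_op [] 2 C = c \<cdot>\<^sub>m V))"

text \<open>Probability of outcome 1 when the first qubit of the N-qubit state v is measured.\<close>

definition prob_first_one :: "nat \<Rightarrow> complex vec \<Rightarrow> real" where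
  "prob_first_one N v = (\<Sum>r | r < 2 ^ N \<and> wire_bit N 0 r = 1. (cmod (v $ r))\<^sup>2)"

text \<open>A distinguishing procedure for n-qubit states is given by a unitary A on m ancilla wires
  initialised to 0 followed by the n input wires; the first wire of all is measured.\<close>

definition accept_prob :: "nat \<Rightarrow> nat \<Rightarrow> complex mat \<Rightarrow> complex vec \<Rightarrow> real" where
  "accept_prob m n A v = prob_first_one (m + n) (A *\<^sub>v with_ancillas m n v)"

definition distinguishes_with_bias ::
  "nat \<Rightarrow> nat \<Rightarrow> complex mat \<Rightarrow> complex vec \<Rightarrow> complex vec \<Rightarrow> real \<Rightarrow> bool" where
  "distinguishes_with_bias m n A v w \<Delta> \<longleftrightarrow>
     is_unitary (2 ^ (m + n)) A \<and> \<bar>accept_prob m n A v - accept_prob m n A w\<bar> = \<Delta>"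

end

theory Submission
  imports Defs
begin

text \<open>
  Both parts rest on the polarization identity: for \<open>\<psi>, \<phi> = (x \<plusminus> y) / \<surd>2\<close>, the difference of
  the expectations of U in \<open>\<psi>\<close> and in \<open>\<phi>\<close> is \<open>\<langle>y|U|x\<rangle> + \<langle>x|U|y\<rangle>\<close>. For (i), the Hadamard test with a
  phase \<open>\<theta>\<close> accepts v with probability \<open>(1 - Re (\<theta> \<langle>v|U|v\<rangle>)) / 2\<close>, and \<open>\<theta>\<close> is chosen to make
  \<open>\<theta> (a + b)\<close> real and nonnegative. The test needs two one-qubit unitaries on the control; each is
  a two-qubit unitary on the control and the first input qubit, which the gate set realises up to
  a phase with boundedly many gates. For (ii), U is \<open>A\<^sup>\<dagger> (Z \<otimes> I) A\<close>, whose expectation in v is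
  1 minus twice the acceptance probability of v.
\<close>

section \<open>Adjoints, the inner product and linear combinations\<close>

lemma mat_adjoint_dim [simp]:
  "dim_row (mat_adjoint A) = dim_col A" "dim_col (mat_adjoint A) = dim_row A"
  unfolding mat_adjoint_def by auto

lemma mat_adjoint_carrier [simp]:
  assumes "A \<in> carrier_mat n m"
  shows "mat_adjoint A \<in> carrier_mat m n"
  using assms by auto

lemma mat_adjoint_index:
  fixes A :: "complex mat"
  assumes "A \<in> carrier_mat n m" "i < m" "j < n"
  shows "mat_adjoint A $$ (i, j) = cnj (A $$ (j, i))"
  using assms unfolding mat_adjoint_def by (simp add: mat_of_rows_index)

lemma mat_adjoint_adjoint:
  fixes A :: "complex mat"
  assumes A: "A \<in> carrier_mat n m"
  shows "mat_adjoint (mat_adjoint A) = A"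
proof (rule eq_matI)
  note A' = mat_adjoint_carrier[OF A] mat_adjoint_carrier[OF mat_adjoint_carrier[OF A]]
  show "dim_row (mat_adjoint (mat_adjoint A)) = dim_row A"
    "dim_col (mat_adjoint (mat_adjoint A)) = dim_col A"
    using A A' by auto
  fix i j assume "i < dim_row A" "j < dim_col A"
  then show "mat_adjoint (mat_adjoint A) $$ (i, j) = A $$ (i, j)"
    using A A' by (simp add: mat_adjoint_index[OF A] mat_adjoint_index[OF A'(1)])
qed

lemma mat_adjoint_mult:
  fixes A B :: "complex mat"
  assumes A: "A \<in> carrier_mat n m" and B: "B \<in> carrier_mat m k"
  shows "mat_adjoint (A * B) = mat_adjoint B * mat_adjoint A"
proof (rule eq_matI)
  have AB: "A * B \<in> carrier_mat n k" using A B by simp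
  note C = mat_adjoint_carrier[OF A] mat_adjoint_carrier[OF B] mat_adjoint_carrier[OF AB]
  show "dim_row (mat_adjoint (A * B)) = dim_row (mat_adjoint B * mat_adjoint A)"
    "dim_col (mat_adjoint (A * B)) = dim_col (mat_adjoint B * mat_adjoint A)"
    using C by auto
  fix i j assume "i < dim_row (mat_adjoint B * mat_adjoint A)"
    "j < dim_col (mat_adjoint B * mat_adjoint A)"
  then have ij: "i < k" "j < n" using C by auto
  have "mat_adjoint (A * B) $$ (i, j) = (\<Sum>t = 0..<m. cnj (A $$ (j, t)) * cnj (B $$ (t, i)))"
    using ij A B by (simp add: mat_adjoint_index[OF AB] scalar_prod_def)
  also have "\<dots> = (\<Sum>t = 0..<m. mat_adjoint B $$ (i, t) * mat_adjoint A $$ (t, j))"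
    using ij by (intro sum.cong) (simp_all add: mat_adjoint_index[OF A] mat_adjoint_index[OF B])
  also have "\<dots> = (mat_adjoint B * mat_adjoint A) $$ (i, j)"
    using ij A B by (simp add: scalar_prod_def)
  finally show "mat_adjoint (A * B) $$ (i, j) = (mat_adjoint B * mat_adjoint A) $$ (i, j)" .
qed

lemma cscalar_prod_sum:
  fixes v w :: "complex vec"
  assumes "w \<in> carrier_vec n"
  shows "v \<bullet>c w = (\<Sum>i = 0..<n. v $ i * cnj (w $ i))"
  using assms by (auto simp: scalar_prod_def)

lemma cscalar_prod_adjoint:
  fixes A :: "complex mat"
  assumes A: "A \<in> carrier_mat n m" and v: "v \<in> carrier_vec m" and w: "w \<in> carrier_vec n"
  shows "(A *\<^sub>v v) \<bullet>c w = v \<bullet>c (mat_adjoint A *\<^sub>v w)"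
proof -
  have A': "mat_adjoint A \<in> carrier_mat m n" using A by simp
  have Aw: "mat_adjoint A *\<^sub>v w \<in> carrier_vec m" using A' w by simp
  have "(A *\<^sub>v v) \<bullet>c w = (\<Sum>i = 0..<n. \<Sum>j = 0..<m. A $$ (i, j) * v $ j * cnj (w $ i))"
    using A v w unfolding cscalar_prod_sum[OF w]
    by (intro sum.cong) (simp_all add: scalar_prod_def sum_distrib_right)
  also have "\<dots> = (\<Sum>j = 0..<m. \<Sum>i = 0..<n. A $$ (i, j) * v $ j * cnj (w $ i))"
    by (rule sum.swap)
  also have "\<dots> = v \<bullet>c (mat_adjoint A *\<^sub>v w)"
    using A w unfolding cscalar_prod_sum[OF Aw]
    by (intro sum.cong) (simp_all add: scalar_prod_def mat_adjoint_index[OF A] sum_distrib_left ac_simps)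
  finally show ?thesis .
qed

lemma cscalar_prod_lincomb:
  fixes x y z w :: "complex vec"
  assumes "x \<in> carrier_vec n" "y \<in> carrier_vec n" "z \<in> carrier_vec n" "w \<in> carrier_vec n"
  shows "(a \<cdot>\<^sub>v x + b \<cdot>\<^sub>v y) \<bullet>c (c \<cdot>\<^sub>v z + d \<cdot>\<^sub>v w) =
    a * cnj c * (x \<bullet>c z) + a * cnj d * (x \<bullet>c w) + b * cnj c * (y \<bullet>c z) + b * cnj d * (y \<bullet>c w)"
proof -
  have zw: "c \<cdot>\<^sub>v z + d \<cdot>\<^sub>v w \<in> carrier_vec n" using assms by simp
  show ?thesis
    unfolding cscalar_prod_sum[OF zw] cscalar_prod_sum[OF assms(3)] cscalar_prod_sum[OF assms(4)]
      sum_distrib_left sum.distrib[symmetric]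
    using assms by (intro sum.cong) (simp_all add: algebra_simps)
qed

lemma cscalar_prod_smult_same:
  fixes x :: "complex vec"
  assumes "x \<in> carrier_vec n"
  shows "(a \<cdot>\<^sub>v x) \<bullet>c (a \<cdot>\<^sub>v x) = (cmod a)\<^sup>2 * (x \<bullet>c x)"
proof -
  have ax: "a \<cdot>\<^sub>v x \<in> carrier_vec n" using assms by simp
  show ?thesis
    using assms unfolding cscalar_prod_sum[OF ax] cscalar_prod_sum[OF assms]
    unfolding complex_norm_square by (simp add: sum_distrib_left ac_simps)
qed

lemma cscalar_prod_cnj:
  fixes x y :: "complex vec"
  assumes "x \<in> carrier_vec n" "y \<in> carrier_vec n"
  shows "y \<bullet>c x = cnj (x \<bullet>c y)"
  unfolding cscalar_prod_sum[OF assms(1)] cscalar_prod_sum[OF assms(2)]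
  by (simp add: ac_simps)

lemma mult_mat_vec_lincomb:
  fixes M :: "complex mat"
  assumes "M \<in> carrier_mat n m" "x \<in> carrier_vec m" "y \<in> carrier_vec m"
  shows "M *\<^sub>v (a \<cdot>\<^sub>v x + b \<cdot>\<^sub>v y) = a \<cdot>\<^sub>v (M *\<^sub>v x) + b \<cdot>\<^sub>v (M *\<^sub>v y)"
  using assms by (simp add: mult_add_distrib_mat_vec mult_mat_vec)

lemma smult_mat_mult_vec:
  fixes M :: "complex mat"
  assumes "M \<in> carrier_mat n m" "v \<in> carrier_vec m"
  shows "(c \<cdot>\<^sub>m M) *\<^sub>v v = c \<cdot>\<^sub>v (M *\<^sub>v v)"
  using assms by (intro eq_vecI) (auto simp: scalar_prod_def sum_distrib_left ac_simps)

lemma assoc_mult_mat3_vec: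
  assumes "A \<in> carrier_mat d d" "B \<in> carrier_mat d d" "C \<in> carrier_mat d d" "v \<in> carrier_vec d"
  shows "(A * B * C) *\<^sub>v v = A *\<^sub>v (B *\<^sub>v (C *\<^sub>v v))"
proof -
  have "A * B \<in> carrier_mat d d" "C *\<^sub>v v \<in> carrier_vec d" using assms by auto
  then show ?thesis
    using assms assoc_mult_mat_vec[of "A * B" d d C d v] assoc_mult_mat_vec[of A d d B d "C *\<^sub>v v"] by simp
qed

section \<open>Closure properties of unitary matrices\<close>

lemma is_unitary_carrier [dest]: "is_unitary d U \<Longrightarrow> U \<in> carrier_mat d d"
  by (simp add: is_unitary_def)

lemma is_unitary_mult:
  assumes "is_unitary d U" "is_unitary d V"
  shows "is_unitary d (U * V)"
proof -
  have U: "U \<in> carrier_mat d d" "mat_adjoint U * U = 1\<^sub>m d"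
    and V: "V \<in> carrier_mat d d" "mat_adjoint V * V = 1\<^sub>m d"
    using assms by (auto simp: is_unitary_def)
  have "mat_adjoint (U * V) * (U * V) = mat_adjoint V * (mat_adjoint U * (U * V))"
    unfolding mat_adjoint_mult[OF U(1) V(1)] using U(1) V(1) by (intro assoc_mult_mat[of _ d d _ d _ d]) auto
  also have "mat_adjoint U * (U * V) = (mat_adjoint U * U) * V"
    using U(1) V(1) by (intro assoc_mult_mat[of _ d d _ d _ d, symmetric]) auto
  finally show ?thesis
    using U V by (simp add: is_unitary_def)
qed

text \<open>\<open>is_unitary\<close> asks for a left inverse; a left inverse of a square matrix is
  also a right inverse.\<close>

lemma is_unitary_adjoint:
  assumes "is_unitary d U"
  shows "is_unitary d (mat_adjoint U)"
proof -
  have U: "U \<in> carrier_mat d d" "mat_adjoint U * U = 1\<^sub>m d"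
    using assms by (auto simp: is_unitary_def)
  then have "U * mat_adjoint U = 1\<^sub>m d"
    by (intro mat_mult_left_right_inverse[of "mat_adjoint U" d U]) auto
  then show ?thesis
    using U by (simp add: is_unitary_def mat_adjoint_adjoint[OF U(1)])
qed

lemma is_unitary_cscalar_prod:
  assumes U: "is_unitary d U" and v: "v \<in> carrier_vec d" "w \<in> carrier_vec d"
  shows "(U *\<^sub>v v) \<bullet>c (U *\<^sub>v w) = v \<bullet>c w"
proof -
  have C: "U \<in> carrier_mat d d" and 1: "mat_adjoint U * U = 1\<^sub>m d"
    using U by (auto simp: is_unitary_def)
  have "(U *\<^sub>v v) \<bullet>c (U *\<^sub>v w) = v \<bullet>c (mat_adjoint U *\<^sub>v (U *\<^sub>v w))"
    using C v by (intro cscalar_prod_adjoint) auto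
  also have "mat_adjoint U *\<^sub>v (U *\<^sub>v w) = (mat_adjoint U * U) *\<^sub>v w"
    using C v by (intro assoc_mult_mat_vec[of _ d d, symmetric]) auto
  finally show ?thesis using 1 v by simp
qed

lemma mult_cnj_of_norm_one: "cmod c = 1 \<Longrightarrow> c * cnj c = 1"
  using complex_norm_square[of c] by simp

text \<open>Needed because the gate set realises unitaries only up to a global phase.\<close>

lemma is_unitary_smult:
  assumes "is_unitary d U" "cmod c = 1"
  shows "is_unitary d (c \<cdot>\<^sub>m U)"
proof -
  have C: "U \<in> carrier_mat d d" and 1: "mat_adjoint U * U = 1\<^sub>m d"
    using assms by (auto simp: is_unitary_def)
  have cC: "c \<cdot>\<^sub>m U \<in> carrier_mat d d" using C by simp
  have "mat_adjoint (c \<cdot>\<^sub>m U) = cnj c \<cdot>\<^sub>m mat_adjoint U"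
    using C mat_adjoint_carrier[OF C] mat_adjoint_carrier[OF cC]
    by (intro eq_matI) (auto simp: mat_adjoint_index[OF C] mat_adjoint_index[OF cC])
  moreover have "(cnj c \<cdot>\<^sub>m mat_adjoint U) * (c \<cdot>\<^sub>m U) = cnj c \<cdot>\<^sub>m (c \<cdot>\<^sub>m (mat_adjoint U * U))"
    using mult_smult_distrib[OF mat_adjoint_carrier[OF C] C, of c]
      mult_smult_assoc_mat[OF mat_adjoint_carrier[OF C] cC, of "cnj c"] by simp
  moreover have "cnj c \<cdot>\<^sub>m (c \<cdot>\<^sub>m 1\<^sub>m d) = 1\<^sub>m d"
    using mult_cnj_of_norm_one[OF assms(2)] by (intro eq_matI) (auto simp: mult.commute)
  ultimately show ?thesis using C 1 by (simp add: is_unitary_def)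
qed

section \<open>Tensor product of a matrix on the leading wires with an identity on the trailing
  ones\<close>

definition kron_id :: "complex mat \<Rightarrow> nat \<Rightarrow> complex mat" where
  "kron_id M d = mat (dim_row M * d) (dim_col M * d)
     (\<lambda>(r, s). if r mod d = s mod d then M $$ (r div d, s div d) else 0)"

lemma kron_id_dim [simp]:
  "dim_row (kron_id M d) = dim_row M * d" "dim_col (kron_id M d) = dim_col M * d"
  by (auto simp: kron_id_def)

lemma kron_id_carrier [simp]: "M \<in> carrier_mat n m \<Longrightarrow> kron_id M d \<in> carrier_mat (n * d) (m * d)"
  by (auto simp: kron_id_def)

lemma kron_id_index:
  assumes "M \<in> carrier_mat n m" "r < n * d" "s < m * d"
  shows "kron_id M d $$ (r, s) = (if r mod d = s mod d then M $$ (r div d, s div d) else 0)"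
  using assms by (auto simp: kron_id_def)

lemma kron_id_smult: "kron_id (c \<cdot>\<^sub>m M) d = c \<cdot>\<^sub>m kron_id M d"
  by (rule eq_matI) (auto simp: kron_id_def less_mult_imp_div_less)

lemma div_mod_eq_iff: "(r :: nat) div d = s div d \<and> r mod d = s mod d \<longleftrightarrow> r = s"
  by (metis div_mult_mod_eq)

lemma kron_id_one: "kron_id (1\<^sub>m n) d = 1\<^sub>m (n * d)"
  by (rule eq_matI) (use div_mod_eq_iff in \<open>auto simp: kron_id_def less_mult_imp_div_less\<close>)

text \<open>In row \<open>r\<close> of \<open>kron_id A d\<close> only the columns \<open>t\<close>
  with \<open>t mod d = r mod d\<close> can be nonzero. They are \<open>u * d + r mod d\<close> for
  \<open>u < m\<close>, so the sum over \<open>m * d\<close> indices collapses to the sum defining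
  the entry of \<open>A * B\<close>.\<close>

lemma kron_id_mult:
  assumes A: "A \<in> carrier_mat n m" and B: "B \<in> carrier_mat m k"
  shows "kron_id (A * B) d = kron_id A d * kron_id B d"
proof (rule eq_matI)
  have AB: "A * B \<in> carrier_mat n k" using A B by simp
  note C = kron_id_carrier[OF A, of d] kron_id_carrier[OF B, of d] kron_id_carrier[OF AB, of d]
  show "dim_row (kron_id (A * B) d) = dim_row (kron_id A d * kron_id B d)"
    "dim_col (kron_id (A * B) d) = dim_col (kron_id A d * kron_id B d)"
    using C by auto
  fix r s assume "r < dim_row (kron_id A d * kron_id B d)" "s < dim_col (kron_id A d * kron_id B d)"
  then have rs: "r < n * d" "s < k * d" using A B by auto
  then have d: "d > 0" by (cases d) auto
  have rs': "r div d < n" "s div d < k" using rs by (auto simp: less_mult_imp_div_less)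
  define f where "f t = kron_id A d $$ (r, t) * kron_id B d $$ (t, s)" for t
  have bound: "u * d + r mod d < m * d" if "u < m" for u
  proof -
    have "u * d + r mod d < Suc u * d" using d by simp
    also have "\<dots> \<le> m * d" using that by (intro mult_right_mono) auto
    finally show ?thesis .
  qed
  have inj: "inj_on (\<lambda>u. u * d + r mod d) {0..<m}"
    using d by (auto intro!: inj_onI)
  have "(kron_id A d * kron_id B d) $$ (r, s) = (\<Sum>t = 0..<m * d. f t)"
    using rs A B by (simp add: scalar_prod_def f_def)
  also have "\<dots> = (\<Sum>t \<in> (\<lambda>u. u * d + r mod d) ` {0..<m}. f t)"
  proof (rule sum.mono_neutral_right)
    show "(\<lambda>u. u * d + r mod d) ` {0..<m} \<subseteq> {0..<m * d}" using bound by auto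
    show "\<forall>t\<in>{0..<m * d} - (\<lambda>u. u * d + r mod d) ` {0..<m}. f t = 0"
    proof
      fix t assume t: "t \<in> {0..<m * d} - (\<lambda>u. u * d + r mod d) ` {0..<m}"
      have "r mod d \<noteq> t mod d"
      proof
        assume "r mod d = t mod d"
        then have "t = t div d * d + r mod d" by simp
        moreover have "t div d \<in> {0..<m}" using t by (auto simp: less_mult_imp_div_less)
        ultimately show False using t by blast
      qed
      then show "f t = 0" using t rs by (simp add: f_def kron_id_index[OF A])
    qed
  qed auto
  also have "\<dots> = (\<Sum>u = 0..<m. f (u * d + r mod d))"
    using sum.reindex[OF inj] by simp
  also have "\<dots> = (\<Sum>u = 0..<m. if r mod d = s mod d then A $$ (r div d, u) * B $$ (u, s div d) else 0)"
    using rs d bound by (intro sum.cong) (auto simp: f_def kron_id_index[OF A] kron_id_index[OF B])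
  also have "\<dots> = kron_id (A * B) d $$ (r, s)"
    using rs rs' A B by (simp add: kron_id_index[OF AB] scalar_prod_def)
  finally show "kron_id (A * B) d $$ (r, s) = (kron_id A d * kron_id B d) $$ (r, s)" by simp
qed

text \<open>Associativity of the tensor product: \<open>r mod (d * e)\<close> carries the same
  information as the pair of \<open>r mod e\<close> and \<open>(r div e) mod d\<close>. It turns a
  gate padded to two wires into the same gate padded to all wires.\<close>

lemma kron_id_kron_id: "kron_id (kron_id M d) e = kron_id M (d * e)"
proof (rule eq_matI)
  fix r s assume "r < dim_row (kron_id M (d * e))" "s < dim_col (kron_id M (d * e))"
  then have rs: "r < dim_row M * (d * e)" "s < dim_col M * (d * e)" by (auto simp: kron_id_def)
  then have e: "e > 0" by (cases e) auto
  have lt: "r div e < dim_row M * d" "s div e < dim_col M * d"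
    using rs by (auto intro!: less_mult_imp_div_less simp: ac_simps)
  have "r mod (d * e) = s mod (d * e) \<longleftrightarrow> r mod e = s mod e \<and> (r div e) mod d = (s div e) mod d"
  proof
    assume *: "r mod (d * e) = s mod (d * e)"
    have "r mod e = s mod e"
      using arg_cong[OF *, of "\<lambda>t. t mod e"] by (simp add: mod_mod_cancel)
    moreover have "(r div e) mod d = (s div e) mod d"
      using * e calculation by (simp add: mod_mult2_eq mult.commute[of d e])
    ultimately show "r mod e = s mod e \<and> (r div e) mod d = (s div e) mod d" ..
  qed (simp add: mod_mult2_eq mult.commute[of d e])
  then show "kron_id (kron_id M d) e $$ (r, s) = kron_id M (d * e) $$ (r, s)"
    using rs lt by (auto simp: kron_id_def div_mult2_eq mult.commute[of d e] mult.assoc)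
qed (auto simp: kron_id_def)

lemma is_unitary_kron_id:
  assumes "is_unitary n U"
  shows "is_unitary (n * d) (kron_id U d)"
proof -
  have U: "U \<in> carrier_mat n n" and 1: "mat_adjoint U * U = 1\<^sub>m n"
    using assms by (auto simp: is_unitary_def)
  note C = kron_id_carrier[OF U, of d]
  have "mat_adjoint (kron_id U d) = kron_id (mat_adjoint U) d"
    using U by (intro eq_matI) (auto simp: mat_adjoint_index[OF U] mat_adjoint_index[OF C]
        kron_id_index[OF U] kron_id_index[OF mat_adjoint_carrier[OF U]] less_mult_imp_div_less)
  then show ?thesis
    using U by (simp add: is_unitary_def kron_id_one 1 flip: kron_id_mult[OF mat_adjoint_carrier[OF U] U])
qed

text \<open>The quotient \<open>r div d\<close> is the value of the leading qubit, so a one-qubit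
  gate on that wire mixes the two halves of a vector by its four entries.\<close>

lemma kron_id_two_by_two:
  assumes "M \<in> carrier_mat 2 2"
  shows "kron_id M d = four_block_mat (M $$ (0, 0) \<cdot>\<^sub>m 1\<^sub>m d) (M $$ (0, 1) \<cdot>\<^sub>m 1\<^sub>m d)
    (M $$ (1, 0) \<cdot>\<^sub>m 1\<^sub>m d) (M $$ (1, 1) \<cdot>\<^sub>m 1\<^sub>m d)" (is "_ = ?F")
proof (rule eq_matI)
  have div: "r div d = 1" "r mod d = r - d" if "\<not> r < d" "r < 2 * d" for r
    using that by (auto simp: div_nat_eqI mod_if le_mod_geq)
  fix r s assume "r < dim_row ?F" "s < dim_col ?F"
  then show "kron_id M d $$ (r, s) = ?F $$ (r, s)"
    using assms div[of r] div[of s] by (cases "r < d"; cases "s < d") (auto simp: kron_id_def)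
qed (use assms in \<open>auto simp: kron_id_def\<close>)

lemma kron_id_two_by_two_mult_vec:
  assumes M: "M \<in> carrier_mat 2 2" and v: "v \<in> carrier_vec d" "w \<in> carrier_vec d"
  shows "kron_id M d *\<^sub>v (v @\<^sub>v w) =
    (M $$ (0, 0) \<cdot>\<^sub>v v + M $$ (0, 1) \<cdot>\<^sub>v w) @\<^sub>v (M $$ (1, 0) \<cdot>\<^sub>v v + M $$ (1, 1) \<cdot>\<^sub>v w)"
proof -
  have 1: "(c \<cdot>\<^sub>m 1\<^sub>m d) *\<^sub>v u = c \<cdot>\<^sub>v u" if "u \<in> carrier_vec d" for c :: complex and u
    using that by (intro eq_vecI) auto
  show ?thesis
    unfolding kron_id_two_by_two[OF M]
    by (subst four_block_mat_mult_vec[of _ d d _ d _ d]) (use v in \<open>auto simp: 1\<close>)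
qed

section \<open>Wires, binary expansions and gates on a prefix of the wires\<close>

lemma wire_bit_eq_bit: "wire_bit N w r = of_bool (bit r (N - 1 - w))"
  by (simp add: wire_bit_def bit_iff_odd mod_2_eq_odd)

lemma mod_power_eq_iff_bits:
  "(r :: nat) mod 2 ^ j = s mod 2 ^ j \<longleftrightarrow> (\<forall>i<j. bit r i \<longleftrightarrow> bit s i)"
  by (auto simp: bit_eq_iff bit_take_bit_iff simp flip: take_bit_eq_mod)

lemma wire_bits_eq_iff_suffix:
  assumes "k \<le> N"
  shows "(\<forall>w<N. k \<le> w \<longrightarrow> wire_bit N w r = wire_bit N w s) \<longleftrightarrow> r mod 2 ^ (N - k) = s mod 2 ^ (N - k)"
proof -
  have "(\<forall>w<N. k \<le> w \<longrightarrow> bit r (N - 1 - w) = bit s (N - 1 - w)) \<longleftrightarrow> (\<forall>i<N - k. bit r i = bit s i)"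
  proof (rule iffI; intro allI impI)
    fix i assume *: "\<forall>w<N. k \<le> w \<longrightarrow> bit r (N - 1 - w) = bit s (N - 1 - w)" and i: "i < N - k"
    \<comment> \<open>The bit of weight \<open>2 ^ i\<close> sits on wire \<open>N - 1 - i\<close>,
      since wire 0 is the most significant.\<close>
    show "bit r i = bit s i" using *[rule_format, of "N - 1 - i"] i by simp
  next
    fix w assume *: "\<forall>i<N - k. bit r i = bit s i" and "w < N" "k \<le> w"
    then show "bit r (N - 1 - w) = bit s (N - 1 - w)" using assms by auto
  qed
  then show ?thesis by (simp add: wire_bit_eq_bit mod_power_eq_iff_bits of_bool_eq_iff)
qed

lemma wire_bit_div:
  assumes "w < k" "k \<le> N"
  shows "wire_bit k w (r div 2 ^ (N - k)) = wire_bit N w r"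
  using assms by (simp add: wire_bit_def flip: div_mult2_eq power_add)

text \<open>Each further wire appends the next lower binary digit, so reading the first
  \<open>k\<close> wires truncates the expansion of \<open>r\<close> after \<open>k\<close>
  digits.\<close>

lemma sub_index_prefix:
  assumes "r < 2 ^ N" "k \<le> N"
  shows "sub_index N [0..<k] r = r div 2 ^ (N - k)"
  using assms(2)
proof (induction k)
  case 0
  then show ?case using assms(1) by (simp add: sub_index_def)
next
  case (Suc k)
  have "N - k = Suc (N - Suc k)" using Suc.prems by simp
  then have "r div 2 ^ (N - k) = r div 2 ^ (N - Suc k) div 2"
    by (simp add: mult.commute[of 2] div_mult2_eq)
  then show ?case
    using Suc by (simp add: sub_index_def wire_bit_def)
qed

lemma sub_index_wires_prefix:
  assumes "set ws \<subseteq> {..<k}" "k \<le> N"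
  shows "sub_index k ws (r div 2 ^ (N - k)) = sub_index N ws r"
  unfolding sub_index_def using assms
  by (intro foldl_cong) (auto simp: wire_bit_div subset_iff)

lemma on_wires_carrier [simp]: "on_wires N ws M \<in> carrier_mat (2 ^ N) (2 ^ N)"
  by (simp add: on_wires_def)

text \<open>No wire is left over to be compared, and reading off all wires in order returns the
  index itself.\<close>

lemma on_wires_all:
  assumes "M \<in> carrier_mat (2 ^ N) (2 ^ N)"
  shows "on_wires N [0..<N] M = M"
  using assms by (intro eq_matI) (auto simp: on_wires_def sub_index_prefix)

text \<open>A gate confined to the first \<open>k\<close> wires leaves the trailing ones alone. This
  reduces every gate in a small circuit to the tensor form, in which products are easy.\<close>

lemma on_wires_kron_id:
  assumes ws: "set ws \<subseteq> {..<k}" and k: "k \<le> N"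
  shows "on_wires N ws M = kron_id (on_wires k ws M) (2 ^ (N - k))"
proof (rule eq_matI)
  have pow: "2 ^ k * 2 ^ (N - k) = (2 :: nat) ^ N" using k by (simp flip: power_add)
  note C = kron_id_carrier[OF on_wires_carrier[of k ws M], of "2 ^ (N - k)"]
  show "dim_row (on_wires N ws M) = dim_row (kron_id (on_wires k ws M) (2 ^ (N - k)))"
    "dim_col (on_wires N ws M) = dim_col (kron_id (on_wires k ws M) (2 ^ (N - k)))"
    using C pow by (auto simp: on_wires_def)
  fix r s assume "r < dim_row (kron_id (on_wires k ws M) (2 ^ (N - k)))"
    "s < dim_col (kron_id (on_wires k ws M) (2 ^ (N - k)))"
  then have rs: "r < 2 ^ N" "s < 2 ^ N" using C pow by auto
  then have rs': "r div 2 ^ (N - k) < 2 ^ k" "s div 2 ^ (N - k) < 2 ^ k"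
    using pow by (auto intro!: less_mult_imp_div_less)
  have "(\<forall>w<N. w \<notin> set ws \<longrightarrow> wire_bit N w r = wire_bit N w s) \<longleftrightarrow>
    (\<forall>w<N. k \<le> w \<longrightarrow> wire_bit N w r = wire_bit N w s) \<and>
    (\<forall>w<k. w \<notin> set ws \<longrightarrow> wire_bit N w r = wire_bit N w s)"
    using ws k by (auto simp: subset_iff)
  then show "on_wires N ws M $$ (r, s) = kron_id (on_wires k ws M) (2 ^ (N - k)) $$ (r, s)"
    using rs rs' k pow kron_id_index[OF on_wires_carrier[of k ws M], of r "2 ^ (N - k)" s]
    unfolding wire_bits_eq_iff_suffix[OF k]
    by (auto simp: on_wires_def wire_bit_div sub_index_wires_prefix[OF ws k])
qed

section \<open>Operators of circuits, and circuits placed on more wires\<close>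

lemma instruction_op_carrier [simp]: "instruction_op bbs N I \<in> carrier_mat (2 ^ N) (2 ^ N)"
  by (cases I) auto

lemma circuit_op_carrier [simp]: "circuit_op bbs N C \<in> carrier_mat (2 ^ N) (2 ^ N)"
proof (induction C)
  case (Cons I C)
  then show ?case using mult_carrier_mat[OF Cons instruction_op_carrier] by simp
qed simp

lemma circuit_op_append: "circuit_op bbs N (C @ D) = circuit_op bbs N D * circuit_op bbs N C"
proof (induction C)
  case Nil
  then show ?case using right_mult_one_mat[OF circuit_op_carrier] by simp
next
  case (Cons I C)
  then show ?case
    using assoc_mult_mat[OF circuit_op_carrier circuit_op_carrier instruction_op_carrier] by simp
qed

text \<open>This transfers the two-wire circuits supplied by universality to the full register:
  their gates act on a prefix of the wires, and their operator does not depend on the black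
  boxes.\<close>

lemma query_free_circuit_on_more_wires:
  assumes "circuit_over G [] k C" "k \<le> N"
  shows "circuit_over G ks N C" "query_count j C = 0"
    "circuit_op bbs N C = kron_id (circuit_op [] k C) (2 ^ (N - k))"
proof -
  have gates: "\<exists>g ws. I = Gate g ws \<and> set ws \<subseteq> {..<k} \<and> instruction_over G ks N I"
    if "I \<in> set C" for I
  proof (cases I)
    case (Gate g ws)
    then have "instruction_over G [] k (Gate g ws)" using that assms(1) unfolding circuit_over_def by metis
    then show ?thesis using Gate assms(2) by auto
  next
    \<comment> \<open>Impossible: the empty list of black boxes admits no index
      \<open>j\<close>.\<close>
    case (Query j ws)
    then have "instruction_over G [] k (Query j ws)" using that assms(1) unfolding circuit_over_def by metis
    then show ?thesis by simp
  qed
  then show "circuit_over G ks N C" by (auto simp: circuit_over_def)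
  show "query_count j C = 0" using gates by (fastforce simp: query_count_def filter_empty_conv)
  from gates show "circuit_op bbs N C = kron_id (circuit_op [] k C) (2 ^ (N - k))"
  proof (induction C)
    case Nil
    then show ?case using assms(2) by (simp add: kron_id_one flip: power_add)
  next
    case (Cons I C)
    obtain g ws where I: "I = Gate g ws" "set ws \<subseteq> {..<k}" using Cons.prems by fastforce
    have "circuit_op bbs N C = kron_id (circuit_op [] k C) (2 ^ (N - k))" using Cons by simp
    then show ?case
      using on_wires_kron_id[OF I(2) assms(2)]
      by (simp add: I(1) kron_id_mult[OF circuit_op_carrier on_wires_carrier])
  qed
qed

section \<open>Measuring the first wire, and adjoining ancillas\<close>

lemma prob_first_one_append:
  assumes "v \<in> carrier_vec (2 ^ k)" "w \<in> carrier_vec (2 ^ k)"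
  shows "complex_of_real (prob_first_one (Suc k) (v @\<^sub>v w)) = w \<bullet>c w"
proof -
  \<comment> \<open>Wire 0 is the leading binary digit, so outcome 1 selects exactly the second half
    of the indices.\<close>
  have idx: "{r. r < 2 ^ Suc k \<and> wire_bit (Suc k) 0 r = 1} = (\<lambda>i. 2 ^ k + i) ` {0..<2 ^ k}"
  proof (intro equalityI subsetI)
    fix r :: nat assume r: "r \<in> {r. r < 2 ^ Suc k \<and> wire_bit (Suc k) 0 r = 1}"
    then have "\<not> r < 2 ^ k" by (auto simp: wire_bit_def)
    then show "r \<in> (\<lambda>i. 2 ^ k + i) ` {0..<2 ^ k}"
      using r by (intro image_eqI[of _ _ "r - 2 ^ k"]) auto
  next
    fix r :: nat assume "r \<in> (\<lambda>i. 2 ^ k + i) ` {0..<2 ^ k}"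
    then obtain i where "r = 2 ^ k + i" "i \<in> {0..<2 ^ k}" by (rule imageE)
    then show "r \<in> {r. r < 2 ^ Suc k \<and> wire_bit (Suc k) 0 r = 1}"
      by (simp add: wire_bit_def div_add_self1)
  qed
  have "prob_first_one (Suc k) (v @\<^sub>v w) = (\<Sum>i = 0..<2 ^ k. (cmod (w $ i))\<^sup>2)"
    unfolding prob_first_one_def idx using assms by (subst sum.reindex) (auto intro!: inj_onI sum.cong)
  then show ?thesis
    unfolding cscalar_prod_sum[OF assms(2)] by (simp only: of_real_sum complex_norm_square)
qed

lemma with_ancillas_carrier [simp]: "with_ancillas m n v \<in> carrier_vec (2 ^ (m + n))"
  by (simp add: with_ancillas_def)

lemma with_ancillas_lincomb:
  assumes "v \<in> carrier_vec (2 ^ n)" "w \<in> carrier_vec (2 ^ n)"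
  shows "with_ancillas m n (a \<cdot>\<^sub>v v + b \<cdot>\<^sub>v w) = a \<cdot>\<^sub>v with_ancillas m n v + b \<cdot>\<^sub>v with_ancillas m n w"
  using assms by (intro eq_vecI) (auto simp: with_ancillas_def)

lemma with_ancillas_cscalar_prod:
  assumes "v \<in> carrier_vec (2 ^ n)" "w \<in> carrier_vec (2 ^ n)"
  shows "with_ancillas m n v \<bullet>c with_ancillas m n w = v \<bullet>c w"
proof -
  have "i < 2 ^ (m + n)" if "i < 2 ^ n" for i :: nat
    using that by (rule less_le_trans) simp
  then show ?thesis
    unfolding cscalar_prod_sum[OF with_ancillas_carrier] cscalar_prod_sum[OF assms(2)]
    by (intro sum.mono_neutral_cong_right) (auto simp: with_ancillas_def)
qed

lemma with_one_ancilla: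
  assumes "v \<in> carrier_vec (2 ^ n)"
  shows "with_ancillas 1 n v = v @\<^sub>v 0\<^sub>v (2 ^ n)"
  using assms by (intro eq_vecI) (auto simp: with_ancillas_def)

section \<open>Normalised sums and differences of states\<close>

lemma ket_plus_lincomb:
  assumes "x \<in> carrier_vec n" "y \<in> carrier_vec n"
  shows "ket_plus x y = (1 / complex_of_real (sqrt 2)) \<cdot>\<^sub>v x + (1 / complex_of_real (sqrt 2)) \<cdot>\<^sub>v y"
  using assms by (simp add: ket_plus_def smult_add_distrib_vec)

lemma ket_minus_lincomb:
  assumes "x \<in> carrier_vec n" "y \<in> carrier_vec n"
  shows "ket_minus x y = (1 / complex_of_real (sqrt 2)) \<cdot>\<^sub>v x + (- 1 / complex_of_real (sqrt 2)) \<cdot>\<^sub>v y"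
  using assms by (intro eq_vecI) (auto simp: ket_minus_def diff_divide_distrib)

lemma half_sqrt2:
  "1 / complex_of_real (sqrt 2) * (1 / complex_of_real (sqrt 2)) = 1 / 2"
  by (simp flip: of_real_mult)

lemma ket_carrier [simp]:
  assumes "x \<in> carrier_vec n" "y \<in> carrier_vec n"
  shows "ket_plus x y \<in> carrier_vec n" "ket_minus x y \<in> carrier_vec n"
  using assms by (auto simp: ket_plus_def ket_minus_def)

lemma is_state_ket:
  assumes "is_state n x" "is_state n y" "x \<bullet>c y = 0"
  shows "is_state n (ket_plus x y)" "is_state n (ket_minus x y)"
proof -
  have C: "x \<in> carrier_vec (2 ^ n)" "y \<in> carrier_vec (2 ^ n)" and 1: "x \<bullet>c x = 1" "y \<bullet>c y = 1"
    using assms by (auto simp: is_state_def)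
  have "y \<bullet>c x = 0" using cscalar_prod_cnj[OF C] assms(3) by simp
  then show "is_state n (ket_plus x y)" "is_state n (ket_minus x y)"
    using C 1 assms(3) half_sqrt2
    by (auto simp: is_state_def ket_plus_lincomb[OF C] ket_minus_lincomb[OF C] cscalar_prod_lincomb[OF C C])
qed

text \<open>On expansion the diagonal terms have coefficient 1/2 in both expectations and cancel,
  while the cross terms have coefficients 1/2 and -1/2 and add up.\<close>

lemma ket_polarization:
  assumes M: "M \<in> carrier_mat n n" and x: "x \<in> carrier_vec n" and y: "y \<in> carrier_vec n"
  shows "(M *\<^sub>v ket_plus x y) \<bullet>c ket_plus x y - (M *\<^sub>v ket_minus x y) \<bullet>c ket_minus x y =
    (M *\<^sub>v x) \<bullet>c y + (M *\<^sub>v y) \<bullet>c x"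
proof -
  have Mxy: "M *\<^sub>v x \<in> carrier_vec n" "M *\<^sub>v y \<in> carrier_vec n" using M x y by auto
  show ?thesis
    unfolding ket_plus_lincomb[OF x y] ket_minus_lincomb[OF x y] mult_mat_vec_lincomb[OF M x y]
      cscalar_prod_lincomb[OF Mxy x y]
    using half_sqrt2 by (simp add: algebra_simps)
qed

text \<open>The Hadamard transform is its own inverse. Part (ii) uses this to read the polarization
  identity with the roles of the two pairs exchanged.\<close>

lemma ket_involution:
  assumes "x \<in> carrier_vec n" "y \<in> carrier_vec n"
  shows "ket_plus (ket_plus x y) (ket_minus x y) = x" "ket_minus (ket_plus x y) (ket_minus x y) = y"
  using assms half_sqrt2
  by (auto intro!: eq_vecI simp: ket_plus_def ket_minus_def field_simps)

lemma cscalar_prod_append: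
  fixes v w v' w' :: "complex vec"
  assumes "v \<in> carrier_vec n" "v' \<in> carrier_vec n" "w \<in> carrier_vec m" "w' \<in> carrier_vec m"
  shows "(v @\<^sub>v w) \<bullet>c (v' @\<^sub>v w') = v \<bullet>c v' + w \<bullet>c w'"
proof -
  have "conjugate (v' @\<^sub>v w') = conjugate v' @\<^sub>v conjugate w'"
    by (intro eq_vecI) auto
  then show ?thesis
    using assms by (simp add: scalar_prod_append[of _ n _ m])
qed

section \<open>The gates: Pauli Z, phased Hadamard and controlled U\<close>

lemma pauli_z_expectation:
  assumes w: "w \<in> carrier_vec (2 ^ Suc k)"
  shows "(kron_id pauli_z (2 ^ k) *\<^sub>v w) \<bullet>c w = w \<bullet>c w - 2 * prob_first_one (Suc k) w"
proof -
  define w0 w1 where "w0 = vec_first w (2 ^ k)" and "w1 = vec_last w (2 ^ k)"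
  have C: "w0 \<in> carrier_vec (2 ^ k)" "w1 \<in> carrier_vec (2 ^ k)"
    by (auto simp: w0_def w1_def)
  have w01: "w = w0 @\<^sub>v w1"
    using w by (simp add: w0_def w1_def mult_2)
  have Z: "pauli_z \<in> carrier_mat 2 2" "pauli_z $$ (0, 0) = 1" "pauli_z $$ (0, 1) = 0"
    "pauli_z $$ (1, 0) = 0" "pauli_z $$ (1, 1) = -1"
    by (auto simp: pauli_z_def mat_of_rows_list_def)
  \<comment> \<open>Z on the leading wire negates the second half, whose squared norm is the
    probability of outcome 1.\<close>
  have "kron_id pauli_z (2 ^ k) *\<^sub>v w = (1 \<cdot>\<^sub>v w0 + 0 \<cdot>\<^sub>v w1) @\<^sub>v (0 \<cdot>\<^sub>v w0 + (-1) \<cdot>\<^sub>v w1)"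
    unfolding w01 kron_id_two_by_two_mult_vec[OF Z(1) C] Z(2-) ..
  also have "\<dots> = w0 @\<^sub>v (-1) \<cdot>\<^sub>v w1"
    using C by (intro eq_vecI) auto
  finally have "(kron_id pauli_z (2 ^ k) *\<^sub>v w) \<bullet>c w = w0 \<bullet>c w0 - w1 \<bullet>c w1"
    using C by (simp add: w01 cscalar_prod_append[of _ "2 ^ k" _ _ "2 ^ k"])
  then show ?thesis
    using C by (simp add: w01 cscalar_prod_append[of _ "2 ^ k" _ _ "2 ^ k"] prob_first_one_append)
qed

lemma is_unitary_pauli_z: "is_unitary 2 pauli_z"
proof -
  have Z: "pauli_z \<in> carrier_mat 2 2" by (auto simp: pauli_z_def mat_of_rows_list_def)
  show ?thesis
    unfolding is_unitary_def
    using Z by (auto intro!: eq_matI simp: mat_adjoint_index[OF Z] scalar_prod_def less_2_cases_iff)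
      (auto simp: pauli_z_def mat_of_rows_list_def numeral_2_eq_2)
qed

text \<open>The Hadamard matrix times the diagonal matrix with entries 1 and \<theta>: the phase on
  control value 1 and the final Hadamard are merged into one one-qubit unitary. For \<theta> = 1 it
  is the Hadamard gate.\<close>

definition phased_hadamard :: "complex \<Rightarrow> complex mat" where
  "phased_hadamard \<theta> = (1 / complex_of_real (sqrt 2)) \<cdot>\<^sub>m mat_of_rows_list 2 [[1, \<theta>], [1, - \<theta>]]"

lemma phased_hadamard_entries:
  "phased_hadamard \<theta> \<in> carrier_mat 2 2"
  "phased_hadamard \<theta> $$ (0, 0) = 1 / complex_of_real (sqrt 2)"
  "phased_hadamard \<theta> $$ (0, 1) = \<theta> / complex_of_real (sqrt 2)"
  "phased_hadamard \<theta> $$ (1, 0) = 1 / complex_of_real (sqrt 2)"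
  "phased_hadamard \<theta> $$ (1, 1) = - \<theta> / complex_of_real (sqrt 2)"
  by (auto simp: phased_hadamard_def mat_of_rows_list_def)

lemma is_unitary_phased_hadamard:
  assumes "cmod \<theta> = 1"
  shows "is_unitary 2 (phased_hadamard \<theta>)"
proof -
  have \<theta>: "cnj \<theta> * \<theta> = 1"
    using mult_cnj_of_norm_one[OF assms] by (simp add: mult.commute)
  note H = phased_hadamard_entries[of \<theta>]
  note H' = H(2-)[unfolded One_nat_def]
  show ?thesis
    unfolding is_unitary_def
    using H(1) half_sqrt2 \<theta>
    by (auto intro!: eq_matI simp: mat_adjoint_index[OF H(1)] scalar_prod_def less_Suc_eq
        numeral_2_eq_2 H' simp flip: of_real_mult)
qed

lemma controlled_mult_vec:
  assumes "U \<in> carrier_mat d d" "v \<in> carrier_vec d" "w \<in> carrier_vec d"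
  shows "controlled U *\<^sub>v (v @\<^sub>v w) = v @\<^sub>v (U *\<^sub>v w)"
  using assms mult_mat_vec_split[of "1\<^sub>m d" d U d v w] by (auto simp: controlled_def Let_def)

lemma is_unitary_controlled:
  assumes "is_unitary d U"
  shows "is_unitary (2 * d) (controlled U)"
proof -
  have U: "U \<in> carrier_mat d d" and 1: "mat_adjoint U * U = 1\<^sub>m d"
    using assms by (auto simp: is_unitary_def)
  have cU: "controlled U = four_block_mat (1\<^sub>m d) (0\<^sub>m d d) (0\<^sub>m d d) U"
    using U by (auto simp: controlled_def Let_def)
  then have C: "controlled U \<in> carrier_mat (d + d) (d + d)"
    using U by simp
  have "mat_adjoint (controlled U) = four_block_mat (1\<^sub>m d) (0\<^sub>m d d) (0\<^sub>m d d) (mat_adjoint U)"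
    unfolding cU using U
    by (intro eq_matI) (auto simp: mat_adjoint_index[OF C[unfolded cU]] mat_adjoint_index[OF U])
  then have "mat_adjoint (controlled U) * controlled U = 1\<^sub>m (d + d)"
    using U 1 by (auto simp: cU mult_four_block_mat[of _ d d _ d _ d _ _ d _ d])
  then show ?thesis
    using C by (simp add: is_unitary_def mult_2)
qed

section \<open>Part (i): the Hadamard test\<close>

lemma hadamard_test_accept_prob:
  assumes U: "is_unitary (2 ^ n) U" and v: "is_state n v"
    and c: "cmod c = 1" "cmod d = 1" and \<theta>: "cmod \<theta> = 1"
  shows "accept_prob 1 n (d \<cdot>\<^sub>m kron_id (phased_hadamard \<theta>) (2 ^ n) * controlled U *
      (c \<cdot>\<^sub>m kron_id (phased_hadamard 1) (2 ^ n))) v = (1 - Re (\<theta> * ((U *\<^sub>v v) \<bullet>c v))) / 2"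
    (is "accept_prob 1 n (?T2 * _ * ?T1) v = _")
proof -
  define h where "h = 1 / complex_of_real (sqrt 2)"
  have hh: "h * h = 1 / 2" using half_sqrt2 by (simp add: h_def)
  have V: "v \<in> carrier_vec (2 ^ n)" "v \<bullet>c v = 1" using v by (auto simp: is_state_def)
  have UC: "U \<in> carrier_mat (2 ^ n) (2 ^ n)" using U by auto
  have Uv: "U *\<^sub>v v \<in> carrier_vec (2 ^ n)" using UC V by simp
  have K: "kron_id (phased_hadamard t) (2 ^ n) \<in> carrier_mat (2 ^ Suc n) (2 ^ Suc n)" for t
    using kron_id_carrier[OF phased_hadamard_entries(1)] by simp
  have CC: "controlled U \<in> carrier_mat (2 ^ Suc n) (2 ^ Suc n)"
    using is_unitary_controlled[OF U] by (auto simp: is_unitary_def)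
  define w where "w = v @\<^sub>v 0\<^sub>v (2 ^ n)"
  have w: "w \<in> carrier_vec (2 ^ Suc n)" using V by (auto simp: w_def mult_2)
  have H: "kron_id (phased_hadamard t) (2 ^ n) *\<^sub>v (p @\<^sub>v q) =
      (h \<cdot>\<^sub>v p + (h * t) \<cdot>\<^sub>v q) @\<^sub>v (h \<cdot>\<^sub>v p + (- h * t) \<cdot>\<^sub>v q)"
    if "p \<in> carrier_vec (2 ^ n)" "q \<in> carrier_vec (2 ^ n)" for t p q
    using kron_id_two_by_two_mult_vec[OF phased_hadamard_entries(1) that, of t]
    by (simp add: phased_hadamard_entries h_def flip: One_nat_def)
  \<comment> \<open>Run the test on the input with its ancilla as control: the first gate makes the
    control uniform, the query applies \<open>U\<close> to the half with control 1, and the last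
    gate lets the halves interfere.\<close>
  have "(?T2 * controlled U * ?T1) *\<^sub>v w = ?T2 *\<^sub>v (controlled U *\<^sub>v (?T1 *\<^sub>v w))"
    using K CC w by (intro assoc_mult_mat3_vec[of _ "2 ^ Suc n"]) auto
  also have "?T1 *\<^sub>v w = (c * h) \<cdot>\<^sub>v v @\<^sub>v (c * h) \<cdot>\<^sub>v v"
  proof -
    have "?T1 *\<^sub>v w = c \<cdot>\<^sub>v (kron_id (phased_hadamard 1) (2 ^ n) *\<^sub>v w)"
      using smult_mat_mult_vec[OF K w] .
    also have "\<dots> = (c * h) \<cdot>\<^sub>v v @\<^sub>v (c * h) \<cdot>\<^sub>v v"
      unfolding w_def using V by (subst H) (auto intro!: eq_vecI)
    finally show ?thesis .
  qed
  also have "controlled U *\<^sub>v \<dots> = (c * h) \<cdot>\<^sub>v v @\<^sub>v (c * h) \<cdot>\<^sub>v (U *\<^sub>v v)"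
    using V UC by (simp add: controlled_mult_vec[of _ "2 ^ n"] mult_mat_vec)
  also have "?T2 *\<^sub>v \<dots> = d \<cdot>\<^sub>v (kron_id (phased_hadamard \<theta>) (2 ^ n) *\<^sub>v \<dots>)"
    using V Uv by (intro smult_mat_mult_vec[OF K]) (auto simp: mult_2)
  \<comment> \<open>Every amplitude carries two factors \<open>h\<close>, one from each Hadamard,
    and \<open>h * h\<close> is 1/2.\<close>
  also have "\<dots> = (d * c / 2) \<cdot>\<^sub>v (1 \<cdot>\<^sub>v v + \<theta> \<cdot>\<^sub>v (U *\<^sub>v v)) @\<^sub>v
      (d * c / 2) \<cdot>\<^sub>v (1 \<cdot>\<^sub>v v + (- \<theta>) \<cdot>\<^sub>v (U *\<^sub>v v))"
  proof -
    have *: "d * (h * (c * h * s) + h * \<theta> * (c * h * t)) = d * c * (s + \<theta> * t) / 2"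
      "d * (h * (c * h * s) - h * \<theta> * (c * h * t)) = d * c * (s - \<theta> * t) / 2" for s t
    proof -
      have "d * (h * (c * h * s) + h * \<theta> * (c * h * t)) = d * c * (s + \<theta> * t) * (h * h)"
        "d * (h * (c * h * s) - h * \<theta> * (c * h * t)) = d * c * (s - \<theta> * t) * (h * h)"
        by (simp_all only: algebra_simps)
      then show "d * (h * (c * h * s) + h * \<theta> * (c * h * t)) = d * c * (s + \<theta> * t) / 2"
        "d * (h * (c * h * s) - h * \<theta> * (c * h * t)) = d * c * (s - \<theta> * t) / 2"
        by (simp_all add: hh)
    qed
    define u where "u = U *\<^sub>v v"
    have "u \<in> carrier_vec (2 ^ n)" using Uv by (simp add: u_def)
    then show ?thesis
      unfolding u_def[symmetric] using V by (subst H) (auto intro!: eq_vecI simp: *)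
  qed
  \<comment> \<open>Acceptance is the squared norm of the half with control 1.\<close>
  finally have "complex_of_real (accept_prob 1 n (?T2 * controlled U * ?T1) v) =
      ((d * c / 2) \<cdot>\<^sub>v (1 \<cdot>\<^sub>v v + (- \<theta>) \<cdot>\<^sub>v (U *\<^sub>v v))) \<bullet>c
      ((d * c / 2) \<cdot>\<^sub>v (1 \<cdot>\<^sub>v v + (- \<theta>) \<cdot>\<^sub>v (U *\<^sub>v v)))"
    using V Uv by (simp only: accept_prob_def with_one_ancilla[OF V(1)] w_def plus_1_eq_Suc)
      (intro prob_first_one_append, auto)
  \<comment> \<open>The phases \<open>c\<close> and \<open>d\<close> have modulus one and drop out
    of the squared norm.\<close>
  also have "\<dots> = (1 / 4) * ((1 \<cdot>\<^sub>v v + (- \<theta>) \<cdot>\<^sub>v (U *\<^sub>v v)) \<bullet>c (1 \<cdot>\<^sub>v v + (- \<theta>) \<cdot>\<^sub>v (U *\<^sub>v v)))"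
    using V Uv c by (subst cscalar_prod_smult_same[of _ "2 ^ n"])
      (auto simp: norm_mult norm_divide power2_eq_square)
  \<comment> \<open>The two cross terms are conjugates of each other, and the norm of
    \<open>U *\<^sub>v v\<close> is that of \<open>v\<close>; the total is twice 1 minus a real
    part.\<close>
  also have "\<dots> = (1 / 4) * (1 - cnj \<theta> * cnj ((U *\<^sub>v v) \<bullet>c v) - \<theta> * ((U *\<^sub>v v) \<bullet>c v) + \<theta> * cnj \<theta>)"
    unfolding cscalar_prod_lincomb[OF V(1) Uv V(1) Uv] is_unitary_cscalar_prod[OF U V(1) V(1)]
      cscalar_prod_cnj[OF Uv V(1)] V(2) by (simp add: algebra_simps)
  also have "\<theta> * cnj \<theta> = 1"
    using \<theta> by (rule mult_cnj_of_norm_one)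
  finally have "accept_prob 1 n (?T2 * controlled U * ?T1) v =
      Re ((1 / 4) * (1 - cnj \<theta> * cnj ((U *\<^sub>v v) \<bullet>c v) - \<theta> * ((U *\<^sub>v v) \<bullet>c v) + 1))"
    by (metis Re_complex_of_real)
  then show ?thesis by (simp add: algebra_simps)
qed

text \<open>The acceptance probabilities differ by minus half the real part of \<theta> times the
  difference of expectations, which polarization evaluates to \<open>s\<close>. The sign disappears
  in the absolute value.\<close>

lemma hadamard_test_bias:
  assumes x: "is_state n x" and y: "is_state n y" and xy: "x \<bullet>c y = 0" and U: "is_unitary (2 ^ n) U"
    and c: "cmod c = 1" "cmod d = 1" and \<theta>: "cmod \<theta> = 1"
    and s: "\<theta> * ((U *\<^sub>v x) \<bullet>c y + (U *\<^sub>v y) \<bullet>c x) = complex_of_real s" "0 \<le> s"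
  shows "distinguishes_with_bias 1 n (d \<cdot>\<^sub>m kron_id (phased_hadamard \<theta>) (2 ^ n) * controlled U *
      (c \<cdot>\<^sub>m kron_id (phased_hadamard 1) (2 ^ n))) (ket_plus x y) (ket_minus x y) (s / 2)"
    (is "distinguishes_with_bias 1 n ?T _ _ _")
proof -
  have "is_unitary (2 ^ (1 + n)) ?T"
    using is_unitary_kron_id[OF is_unitary_phased_hadamard[OF \<theta>], of "2 ^ n"]
      is_unitary_kron_id[OF is_unitary_phased_hadamard[of 1], of "2 ^ n"] is_unitary_controlled[OF U] c
    by (auto intro!: is_unitary_mult is_unitary_smult)
  moreover have "accept_prob 1 n ?T (ket_plus x y) - accept_prob 1 n ?T (ket_minus x y) = - (s / 2)"
  proof -
    have "\<theta> * ((U *\<^sub>v ket_plus x y) \<bullet>c ket_plus x y) - \<theta> * ((U *\<^sub>v ket_minus x y) \<bullet>c ket_minus x y) =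
        \<theta> * ((U *\<^sub>v x) \<bullet>c y + (U *\<^sub>v y) \<bullet>c x)"
      using x y U by (subst ket_polarization[of _ "2 ^ n", symmetric]) (auto simp: is_state_def algebra_simps)
    then have "Re (\<theta> * ((U *\<^sub>v ket_plus x y) \<bullet>c ket_plus x y)) -
        Re (\<theta> * ((U *\<^sub>v ket_minus x y) \<bullet>c ket_minus x y)) = s"
      unfolding s(1) by (metis Re_complex_of_real minus_complex.sel(1))
    moreover have "(1 - p) / 2 - (1 - q) / 2 = - (s / 2)" if "p - q = s" for p q :: real
      using that by (simp add: field_simps)
    ultimately show ?thesis
      unfolding hadamard_test_accept_prob[OF U is_state_ket(1)[OF x y xy] c \<theta>]
        hadamard_test_accept_prob[OF U is_state_ket(2)[OF x y xy] c \<theta>] by blast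
  qed
  ultimately show ?thesis using s(2) by (simp add: distinguishes_with_bias_def)
qed

text \<open>The circuit depends on \<open>a\<close> and \<open>b\<close> only through the phase
  \<theta>, and \<open>K\<close> bounds the cost of each of its two gates uniformly in that phase,
  so \<open>2 * K\<close> serves for every \<open>n\<close>, \<open>a\<close> and
  \<open>b\<close>.\<close>

lemma hadamard_test_circuit:
  assumes G: "universal_gate_set G"
  shows "\<exists>c. \<forall>n\<ge>1. \<forall>a b. \<exists>m C.
        circuit_over G [Suc n] (m + n) C \<and> query_count 0 C = 1 \<and> gate_count C \<le> c \<and>
        (\<forall>x y U.
           is_state n x \<and> is_state n y \<and> x \<bullet>c y = 0 \<and> is_unitary (2 ^ n) U \<and>
           (U *\<^sub>v x) \<bullet>c y = a \<and> (U *\<^sub>v y) \<bullet>c x = b \<longrightarrow>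
           distinguishes_with_bias m n (circuit_op [controlled U] (m + n) C)
             (ket_plus x y) (ket_minus x y) (cmod (a + b) / 2))"
proof -
  obtain K where K: "\<And>V. is_unitary 4 V \<Longrightarrow> \<exists>C c. circuit_over G [] 2 C \<and> gate_count C \<le> K \<and>
      cmod c = 1 \<and> circuit_op [] 2 C = c \<cdot>\<^sub>m V"
    using G unfolding universal_gate_set_def by blast
  \<comment> \<open>Universality speaks of two-qubit unitaries, so the one-qubit gate is padded by
    one idle wire.\<close>
  have H: "\<exists>C c. circuit_over G [] 2 C \<and> gate_count C \<le> K \<and> cmod c = 1 \<and>
      circuit_op [] 2 C = c \<cdot>\<^sub>m kron_id (phased_hadamard \<theta>) 2" if "cmod \<theta> = 1" for \<theta>
    using K[of "kron_id (phased_hadamard \<theta>) 2"]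
      is_unitary_kron_id[OF is_unitary_phased_hadamard[OF that], of 2] by simp
  have "\<exists>m C. circuit_over G [Suc n] (m + n) C \<and> query_count 0 C = 1 \<and> gate_count C \<le> 2 * K \<and>
        (\<forall>x y U.
           is_state n x \<and> is_state n y \<and> x \<bullet>c y = 0 \<and> is_unitary (2 ^ n) U \<and>
           (U *\<^sub>v x) \<bullet>c y = a \<and> (U *\<^sub>v y) \<bullet>c x = b \<longrightarrow>
           distinguishes_with_bias m n (circuit_op [controlled U] (m + n) C)
             (ket_plus x y) (ket_minus x y) (cmod (a + b) / 2))" if n: "n \<ge> 1" for n a b
  proof -
    obtain \<theta> where \<theta>: "cmod \<theta> = 1" "\<theta> * (a + b) = complex_of_real (cmod (a + b))"
    proof (cases "a + b = 0")
      case False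
      \<comment> \<open>The phase that rotates \<open>a + b\<close> onto the nonnegative real axis;
        if \<open>a + b\<close> is 0, the phase 1 will do.\<close>
      have "cnj (a + b) / cmod (a + b) * (a + b) = complex_of_real (cmod (a + b))"
        using False complex_norm_square[of "a + b"] by (simp add: field_simps power2_eq_square)
      moreover have "cmod (cnj (a + b) / cmod (a + b)) = 1"
        using False by (simp add: norm_divide del: complex_cnj_add)
      ultimately show ?thesis using that by blast
    qed (use that[of 1] in simp)
    obtain C1 c1 where C1: "circuit_over G [] 2 C1" "gate_count C1 \<le> K" "cmod c1 = 1"
        "circuit_op [] 2 C1 = c1 \<cdot>\<^sub>m kron_id (phased_hadamard 1) 2"
      using H[of 1] by auto
    obtain C2 c2 where C2: "circuit_over G [] 2 C2" "gate_count C2 \<le> K" "cmod c2 = 1"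
        "circuit_op [] 2 C2 = c2 \<cdot>\<^sub>m kron_id (phased_hadamard \<theta>) 2"
      using H[OF \<theta>(1)] by auto
    define C where "C = C1 @ [Query 0 [0..<1 + n]] @ C2"
    \<comment> \<open>The idle wire of the padded gates is the first input qubit, hence
      \<open>n \<ge> 1\<close>. The second equation merges the padding by 2 with the padding of the
      remaining wires.\<close>
    have N: "2 \<le> 1 + n" "2 * 2 ^ (1 + n - 2) = (2 :: nat) ^ n"
      using n by (auto simp flip: power_Suc)
    note L1 = query_free_circuit_on_more_wires[OF C1(1) N(1)]
    note L2 = query_free_circuit_on_more_wires[OF C2(1) N(1)]
    have over: "circuit_over G [Suc n] (1 + n) C"
      using L1(1)[of "[Suc n]"] L2(1)[of "[Suc n]"] by (auto simp: circuit_over_def C_def)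
    have q: "query_count 0 C = 1"
      using L1(2)[of 0] L2(2)[of 0] by (simp add: query_count_def C_def)
    have g: "gate_count C \<le> 2 * K"
      using C1(2) C2(2) by (simp add: gate_count_def C_def)
    have op: "circuit_op [controlled U] (1 + n) C =
        c2 \<cdot>\<^sub>m kron_id (phased_hadamard \<theta>) (2 ^ n) * controlled U *
        (c1 \<cdot>\<^sub>m kron_id (phased_hadamard 1) (2 ^ n))" if "is_unitary (2 ^ n) U" for U
    proof -
      have CU: "controlled U \<in> carrier_mat (2 ^ (1 + n)) (2 ^ (1 + n))"
        using is_unitary_controlled[OF that] by (auto simp: is_unitary_def)
      \<comment> \<open>The query takes all wires in order, so the ancilla on wire 0 is the
        control.\<close>
      have "circuit_op [controlled U] (1 + n) [Query 0 [0..<1 + n]] = controlled U"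
        using on_wires_all[OF CU] CU by simp
      then show ?thesis
        unfolding C_def circuit_op_append L1(3) L2(3) C1(4) C2(4) kron_id_smult kron_id_kron_id N(2)
        by (simp only:)
    qed
    show ?thesis
    proof (intro exI conjI allI impI)
      fix x y U
      assume *: "is_state n x \<and> is_state n y \<and> x \<bullet>c y = 0 \<and> is_unitary (2 ^ n) U \<and>
        (U *\<^sub>v x) \<bullet>c y = a \<and> (U *\<^sub>v y) \<bullet>c x = b"
      then have x: "is_state n x" and y: "is_state n y" and xy: "x \<bullet>c y = 0"
        and U: "is_unitary (2 ^ n) U" by blast+
      have "\<theta> * ((U *\<^sub>v x) \<bullet>c y + (U *\<^sub>v y) \<bullet>c x) = complex_of_real (cmod (a + b))"
        using * \<theta>(2) by blast
      then show "distinguishes_with_bias 1 n (circuit_op [controlled U] (1 + n) C)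
             (ket_plus x y) (ket_minus x y) (cmod (a + b) / 2)"
        unfolding op[OF U] by (intro hadamard_test_bias[OF x y xy U C1(3) C2(3) \<theta>(1)]) auto
    qed (use over q g in auto)
  qed
  then show ?thesis by blast
qed

section \<open>Part (ii): conjugating a Pauli Z by the distinguishing procedure\<close>

lemma reflection_expectation:
  assumes A: "is_unitary (2 ^ (m + n)) A" and v: "is_state n v" and N: "m + n = Suc k"
  shows "((mat_adjoint A * kron_id pauli_z (2 ^ k) * A) *\<^sub>v with_ancillas m n v) \<bullet>c with_ancillas m n v =
    1 - 2 * accept_prob m n A v"
proof -
  let ?w = "with_ancillas m n v" and ?Z = "kron_id pauli_z (2 ^ k)"
  have C: "A \<in> carrier_mat (2 ^ Suc k) (2 ^ Suc k)" "?Z \<in> carrier_mat (2 ^ Suc k) (2 ^ Suc k)"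
    "?w \<in> carrier_vec (2 ^ Suc k)"
    using A N with_ancillas_carrier[of m n v] is_unitary_kron_id[OF is_unitary_pauli_z, of "2 ^ k"]
    by (auto simp: is_unitary_def)
  have Aw: "A *\<^sub>v ?w \<in> carrier_vec (2 ^ Suc k)" using C by simp
  have "(mat_adjoint A * ?Z * A) *\<^sub>v ?w = mat_adjoint A *\<^sub>v (?Z *\<^sub>v (A *\<^sub>v ?w))"
    using C mat_adjoint_carrier[OF C(1)]
    by (intro assoc_mult_mat3_vec[of _ "2 ^ Suc k"]) auto
  \<comment> \<open>Moving the adjoint of \<open>A\<close> across the inner product leaves the
    expectation of Z on the measured wire in the output state of \<open>A\<close>.\<close>
  also have "\<dots> \<bullet>c ?w = (?Z *\<^sub>v (A *\<^sub>v ?w)) \<bullet>c (A *\<^sub>v ?w)"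
    using C Aw mat_adjoint_adjoint[OF C(1)]
    by (subst cscalar_prod_adjoint[of _ "2 ^ Suc k" "2 ^ Suc k"]) auto
  also have "\<dots> = (A *\<^sub>v ?w) \<bullet>c (A *\<^sub>v ?w) - 2 * accept_prob m n A v"
    by (simp add: pauli_z_expectation[OF Aw] accept_prob_def N)
  also have "(A *\<^sub>v ?w) \<bullet>c (A *\<^sub>v ?w) = 1"
    using v by (subst is_unitary_cscalar_prod[OF A]) (auto simp: with_ancillas_cscalar_prod is_state_def)
  finally show ?thesis by simp
qed

text \<open>Computing with \<open>A\<close>, flipping the sign of the accepting outcome and
  uncomputing yields a unitary whose expectations encode acceptance probabilities. The wires and the
  gate are chosen before \<open>A\<close> and the states.\<close>

lemma reflection_circuit:
  assumes n: "n \<ge> 1"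
  shows "\<exists>C.
        circuit_over (insert pauli_z G) [m + n, m + n] (m + n) C \<and>
        query_count 0 C = 1 \<and> query_count 1 C = 1 \<and> gate_count C = 1 \<and>
        (\<forall>\<psi> \<phi> A p \<Delta>.
           is_state n \<psi> \<and> is_state n \<phi> \<and> \<psi> \<bullet>c \<phi> = 0 \<and> is_unitary (2 ^ (m + n)) A \<and>
           accept_prob m n A \<psi> = p \<and> accept_prob m n A \<phi> = p - \<Delta> \<and> 0 \<le> \<Delta> \<longrightarrow>
           (let U = circuit_op [A, mat_adjoint A] (m + n) C;
                x = with_ancillas m n (ket_plus \<psi> \<phi>);
                y = with_ancillas m n (ket_minus \<psi> \<phi>)
            in is_unitary (2 ^ (m + n)) U \<and>
               cmod ((U *\<^sub>v x) \<bullet>c y + (U *\<^sub>v y) \<bullet>c x) / 2 = \<Delta>))"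
proof -
  \<comment> \<open>Besides the measured wire there are \<open>k\<close> others;
    \<open>n \<ge> 1\<close> guarantees that there is a wire to measure.\<close>
  obtain k where N: "m + n = Suc k" using n by (metis Suc_le_D add_Suc_right One_nat_def)
  \<comment> \<open>Black box 0 will be \<open>A\<close> and black box 1 its adjoint.\<close>
  define C where "C = [Query 0 [0..<m + n], Gate pauli_z [0], Query 1 [0..<m + n]]"
  have Z: "pauli_z \<in> carrier_mat 2 2" using is_unitary_pauli_z by auto
  have over: "circuit_over (insert pauli_z G) [m + n, m + n] (m + n) C"
    using n Z by (auto simp: circuit_over_def C_def)
  have counts: "query_count 0 C = 1" "query_count 1 C = 1" "gate_count C = 1"
    by (auto simp: query_count_def gate_count_def C_def)
  have gate: "on_wires (m + n) [0] pauli_z = kron_id pauli_z (2 ^ k)"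
    using on_wires_kron_id[of "[0]" 1 "m + n" pauli_z] on_wires_all[of pauli_z 1] Z N by simp
  have op: "circuit_op [A, mat_adjoint A] (m + n) C = mat_adjoint A * kron_id pauli_z (2 ^ k) * A"
    if "is_unitary (2 ^ (m + n)) A" for A
  proof -
    have A: "A \<in> carrier_mat (2 ^ (m + n)) (2 ^ (m + n))" using that by auto
    show ?thesis
      using on_wires_all[OF A] on_wires_all[OF mat_adjoint_carrier[OF A]] A gate
        left_mult_one_mat[OF mat_adjoint_carrier[OF A]]
      by (simp add: C_def)
  qed
  have bias: "is_unitary (2 ^ (m + n)) U \<and>
      cmod ((U *\<^sub>v with_ancillas m n (ket_plus \<psi> \<phi>)) \<bullet>c with_ancillas m n (ket_minus \<psi> \<phi>) +
        (U *\<^sub>v with_ancillas m n (ket_minus \<psi> \<phi>)) \<bullet>c with_ancillas m n (ket_plus \<psi> \<phi>)) / 2 = \<Delta>"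
    if \<psi>: "is_state n \<psi>" and \<phi>: "is_state n \<phi>" and A: "is_unitary (2 ^ (m + n)) A"
      and p: "accept_prob m n A \<psi> = p" "accept_prob m n A \<phi> = p - \<Delta>" and \<Delta>: "0 \<le> \<Delta>"
      and U: "U = circuit_op [A, mat_adjoint A] (m + n) C" for \<psi> \<phi> A p \<Delta> U
  proof
    note U' = U[unfolded op[OF A]]
    show Uu: "is_unitary (2 ^ (m + n)) U"
      using A is_unitary_adjoint[OF A] is_unitary_kron_id[OF is_unitary_pauli_z, of "2 ^ k"] N
      unfolding U' by (auto intro!: is_unitary_mult)
    have c: "\<psi> \<in> carrier_vec (2 ^ n)" "\<phi> \<in> carrier_vec (2 ^ n)" using \<psi> \<phi> by (auto simp: is_state_def)
    let ?x = "with_ancillas m n (ket_plus \<psi> \<phi>)" and ?y = "with_ancillas m n (ket_minus \<psi> \<phi>)"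
    \<comment> \<open>Adjoining ancillas is linear, so it commutes with forming the normalised sum
      and difference.\<close>
    have kets: "?x = ket_plus (with_ancillas m n \<psi>) (with_ancillas m n \<phi>)"
      "?y = ket_minus (with_ancillas m n \<psi>) (with_ancillas m n \<phi>)"
      unfolding ket_plus_lincomb[OF c] ket_minus_lincomb[OF c] with_ancillas_lincomb[OF c]
        ket_plus_lincomb[OF with_ancillas_carrier with_ancillas_carrier]
        ket_minus_lincomb[OF with_ancillas_carrier with_ancillas_carrier] by (rule refl)+
    \<comment> \<open>Polarization applied to \<open>?x\<close> and \<open>?y\<close>, whose
      normalised sum and difference are \<psi> and \<phi> with ancillas.\<close>
    have "(U *\<^sub>v ?x) \<bullet>c ?y + (U *\<^sub>v ?y) \<bullet>c ?x =
        (U *\<^sub>v with_ancillas m n \<psi>) \<bullet>c with_ancillas m n \<psi> -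
        (U *\<^sub>v with_ancillas m n \<phi>) \<bullet>c with_ancillas m n \<phi>"
      using ket_polarization[of U "2 ^ (m + n)" ?x ?y] Uu
      by (auto simp: kets ket_involution[of _ "2 ^ (m + n)"])
    \<comment> \<open>The difference of \<open>1 - 2 * p\<close> and
      \<open>1 - 2 * (p - \<Delta>)\<close>; the factor 2 is removed by the division by 2 in the
      goal.\<close>
    also have "\<dots> = - 2 * complex_of_real \<Delta>"
      unfolding U' reflection_expectation[OF A \<psi> N] reflection_expectation[OF A \<phi> N] p by simp
    finally show "cmod ((U *\<^sub>v ?x) \<bullet>c ?y + (U *\<^sub>v ?y) \<bullet>c ?x) / 2 = \<Delta>"
      using \<Delta> by (simp add: norm_mult)
  qed
  show ?thesis
    using over counts bias by (intro exI[of _ C]) (auto simp: Let_def)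
qed

theorem theorem2:
  fixes G :: "complex mat set"
  assumes "universal_gate_set G"
  shows
    "(\<exists>c. \<forall>n\<ge>1. \<forall>a b. \<exists>m C.
        circuit_over G [Suc n] (m + n) C \<and> query_count 0 C = 1 \<and> gate_count C \<le> c \<and>
        (\<forall>x y U.
           is_state n x \<and> is_state n y \<and> x \<bullet>c y = 0 \<and> is_unitary (2 ^ n) U \<and>
           (U *\<^sub>v x) \<bullet>c y = a \<and> (U *\<^sub>v y) \<bullet>c x = b \<longrightarrow>
           distinguishes_with_bias m n (circuit_op [controlled U] (m + n) C)
             (ket_plus x y) (ket_minus x y) (cmod (a + b) / 2)))
     \<and>
     (\<forall>m. \<forall>n\<ge>1. \<exists>C.
        circuit_over (insert pauli_z G) [m + n, m + n] (m + n) C \<and>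
        query_count 0 C = 1 \<and> query_count 1 C = 1 \<and> gate_count C = 1 \<and>
        (\<forall>\<psi> \<phi> A p \<Delta>.
           is_state n \<psi> \<and> is_state n \<phi> \<and> \<psi> \<bullet>c \<phi> = 0 \<and> is_unitary (2 ^ (m + n)) A \<and>
           accept_prob m n A \<psi> = p \<and> accept_prob m n A \<phi> = p - \<Delta> \<and> 0 \<le> \<Delta> \<longrightarrow>
           (let U = circuit_op [A, mat_adjoint A] (m + n) C;
                x = with_ancillas m n (ket_plus \<psi> \<phi>);
                y = with_ancillas m n (ket_minus \<psi> \<phi>)
            in is_unitary (2 ^ (m + n)) U \<and>
               cmod ((U *\<^sub>v x) \<bullet>c y + (U *\<^sub>v y) \<bullet>c x) / 2 = \<Delta>)))"
  using hadamard_test_circuit[OF assms] reflection_circuit by blast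

end
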